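(* Let $A\in\mathbb{R}^{n\times n}$ and $B\in\mathbb{R}^{n\times m}$ be such that the pair $(B^{T},A^{T})$ is detectable. Let $P$ be the (unique) symmetric positive definite solution $P=P^{T}>0$ of the algebraic Riccati equation $$A^{T}P+PA+I_{n}-PBB^{T}P=0,$$ and let $L:=PB\in\mathbb{R}^{n\times m}$. Let $\delta>0$ be given. Then for every positive integer $p$ and every connected matrix $\Gamma=[\gamma_{ij}]\in\mathbb{R}^{p\times p}$ with $-\mathrm{Re}(\lambda_{2}(\Gamma))\geq\delta$, the following holds. Consider the $p$ coupled systems $$\dot{x}_{i}=A^{T}x_{i}+u_{i},\qquad y_{i}=B^{T}x_{i},\qquad u_{i}=\max\{1,\delta^{-1}\}\,L z_{i},\qquad z_{i}=\sum_{j=1}^{p}\gamma_{ij}(y_{j}-y_{i}),\qquad i=1,2,\ldots,p,$$ with $x_i(t)\in\mathbb{R}^{n}$, $y_i(t)\in\mathbb{R}^m$, $t\ge 0$. Then for all initial conditions $x_{1}(0),\ldots,x_{p}(0)\in\mathbb{R}^{n}$, the solutions $x_{i}(\cdot)$, $i=1,\ldots,p$, synchronize to $$\bar{x}(t):=(r^{T}\otimes e^{A^{T}t})\begin{bmatrix}x_{1}(0)\\ \vdots\\ x_{p}(0)\end{bmatrix},$$ i.e. $|x_{i}(t)-\bar{x}(t)|\to 0$ as $t\to\infty$ for all $i$, where $r\in\mathbb{R}^{p}$ satisfies $r^{T}\Gamma=0$ and $r^{T}\mathbf{1}=1$.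
   Context: Notation: $|\cdot|$ is the 2-norm, $\otimes$ is the Kronecker product, $I_n$ is the $n\times n$ identity matrix, and $\mathbf{1}\in\mathbb{R}^{p}$ is the vector with all entries equal to one. A square complex matrix is Hurwitz if all its eigenvalues have strictly negative real parts. For $F\in\mathbb{R}^{n\times n}$, $G\in\mathbb{R}^{n\times m}$, the pair $(F,G)$ is stabilizable if there exists $K_0\in\mathbb{R}^{m\times n}$ such that $F-GK_0$ is Hurwitz; for $C\in\mathbb{R}^{m\times n}$, the pair $(C,F)$ is detectable if $(F^{T},C^{T})$ is stabilizable. Thus $(B^T,A^T)$ detectable means $(A,B)$ stabilizable, in which case the Riccati equation in the claim is known to have a unique symmetric positive definite solution. Graphs: a (directed) graph is a pair $(\mathcal{N},\mathcal{A})$ with $\mathcal{N}$ a nonempty finite set of nodes and $\mathcal{A}$ a finite collection of ordered pairs (arcs) of nodes. A path from $n_1$ to $n_\ell$ is a sequence of nodes $n_1,n_2,\ldots,n_\ell$ such that $(n_i,n_{i+1})$ is an arc for $i=1,\ldots,\ell-1$. A graph is connected if it has a node to which there exists a path from every other node. The graph of a matrix $\Gamma=[\gamma_{ij}]\in\mathbb{R}^{p\times p}$ has nodes $n_1,\ldots,n_p$, with $(n_i,n_j)$ an arc if and only if $\gamma_{ij}>0$. Connected matrix: $\Gamma=[\gamma_{ij}]\in\mathbb{R}^{p\times p}$ is called connected if (i) $\gamma_{ij}\ge 0$ for $i\ne j$; (ii) each row sum equals $0$; (iii) its graph is connected. It is a known fact that a connected $\Gamma$ has an eigenvalue $0$ (with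 eigenvector $\mathbf{1}$) and all its other eigenvalues have strictly negative real parts. $\mathrm{Re}(\lambda_{2}(\Gamma))$ denotes the real part of a nonzero eigenvalue of $\Gamma$ closest to the imaginary axis; thus the condition $-\mathrm{Re}(\lambda_2(\Gamma))\ge\delta$ means that every nonzero eigenvalue $\lambda$ of $\Gamma$ satisfies $\mathrm{Re}(\lambda)\le-\delta$. *)

theory Defs
  imports "HOL-Analysis.Analysis"
begin

definition is_eigenvalue :: "complex^'n^'n \<Rightarrow> complex \<Rightarrow> bool" where
  "is_eigenvalue M l \<longleftrightarrow> (\<exists>v. v \<noteq> 0 \<and> M *v v = l *s v)"

definition hurwitz :: "complex^'n^'n \<Rightarrow> bool" where
  "hurwitz M \<longleftrightarrow> (\<forall>l. is_eigenvalue M l \<longrightarrow> Re l < 0)"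

definition stabilizable :: "real^'n^'n \<Rightarrow> real^'m^'n \<Rightarrow> bool" where
  "stabilizable F G \<longleftrightarrow>
     (\<exists>K0 :: real^'n^'m. hurwitz (map_matrix complex_of_real (F - G ** K0)))"

definition detectable :: "real^'n^'m \<Rightarrow> real^'n^'n \<Rightarrow> bool" where
  "detectable C F \<longleftrightarrow> stabilizable (transpose F) (transpose C)"

definition sym_pos_def :: "real^'n^'n \<Rightarrow> bool" where
  "sym_pos_def P \<longleftrightarrow> transpose P = P \<and> (\<forall>v. v \<noteq> 0 \<longrightarrow> v \<bullet> (P *v v) > 0)"

text \<open>A directed graph is a pair of a node set and an arc set. A path is a list of nodes.\<close>

type_synonym 'v graph = "'v set \<times> ('v \<times> 'v) set"

definition is_path :: "'v graph \<Rightarrow> 'v \<Rightarrow> 'v list \<Rightarrow> 'v \<Rightarrow> bool" where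
  "is_path G u ns v \<longleftrightarrow> ns \<noteq> [] \<and> hd ns = u \<and> last ns = v \<and> set ns \<subseteq> fst G \<and>
     successively (\<lambda>a b. (a, b) \<in> snd G) ns"

definition connected_graph :: "'v graph \<Rightarrow> bool" where
  "connected_graph G \<longleftrightarrow> (\<exists>v \<in> fst G. \<forall>u \<in> fst G - {v}. \<exists>ns. is_path G u ns v)"

definition graph_of_matrix :: "real^'p^'p \<Rightarrow> 'p graph" where
  "graph_of_matrix \<Gamma> = (UNIV, {(i, j). \<Gamma> $ i $ j > 0})"

definition connected_matrix :: "real^'p^'p \<Rightarrow> bool" where
  "connected_matrix \<Gamma> \<longleftrightarrow>
     (\<forall>i j. i \<noteq> j \<longrightarrow> \<Gamma> $ i $ j \<ge> 0) \<and>
     (\<forall>i. (\<Sum>j\<in>UNIV. \<Gamma> $ i $ j) = 0) \<and>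
     connected_graph (graph_of_matrix \<Gamma>)"

text \<open>A nonzero eigenvalue closest to the imaginary axis. This is a relation rather than a
  function, since such an eigenvalue need not be unique (although, for connected matrices, its real
  part is), and does not exist for the connected \<open>1 \<times> 1\<close> matrix.\<close>

definition is_lambda2 :: "real^'p^'p \<Rightarrow> complex \<Rightarrow> bool" where
  "is_lambda2 \<Gamma> l \<longleftrightarrow>
     is_eigenvalue (map_matrix complex_of_real \<Gamma>) l \<and> l \<noteq> 0 \<and>
     (\<forall>k. is_eigenvalue (map_matrix complex_of_real \<Gamma>) k \<and> k \<noteq> 0 \<longrightarrow> \<bar>Re l\<bar> \<le> \<bar>Re k\<bar>)"

text \<open>The library's power and \<open>exp\<close> are not usable here: multiplication on the type of
  vectors is componentwise.\<close>

definition matrix_power :: "real^'n^'n \<Rightarrow> nat \<Rightarrow> real^'n^'n" where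
  "matrix_power M k = (((**) M) ^^ k) (mat 1)"

definition matrix_exp :: "real^'n^'n \<Rightarrow> real^'n^'n" where
  "matrix_exp M = (\<Sum>k. (1 / fact k) *\<^sub>R matrix_power M k)"

text \<open>Rows and columns of a Kronecker product are indexed by pairs, the first component being the
  block index. Accordingly \<open>stack x\<close> is the column of blocks \<open>x i\<close>. Vectors with a single
  block are identified with that block by \<open>single_block\<close>.\<close>

definition kronecker :: "real^'b^'a \<Rightarrow> real^'d^'c \<Rightarrow> real^('b \<times> 'd)^('a \<times> 'c)" where
  "kronecker M N = (\<chi> r s. M $ fst r $ fst s * N $ snd r $ snd s)"

definition stack :: "('p::finite \<Rightarrow> real^'n) \<Rightarrow> real^('p \<times> 'n)" where
  "stack x = (\<chi> r. x (fst r) $ snd r)"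

definition single_block :: "real^(1 \<times> 'n) \<Rightarrow> real^'n" where
  "single_block w = (\<chi> i. w $ (1, i))"

end

(* Subtracting the weighted mean r^T x = xbar from all the x_i leaves a matrix E of errors (one row
   per system) with E' = E A + mu Gamma E B B^T P and r^T E = 0. A polynomial q with q(Gamma) = 0 is
   split into linear factors that are peeled off one at a time: if (Gamma - l) Y -> 0 for a solution
   Y = q'(Gamma) E, then Y -> 0. Indeed, either Gamma - l is injective on the annihilator of r, or l
   is an eigenvalue with Re l <= -delta, and then Y' = Y A + mu l Y B B^T P + o(1), for which
   tr(Y P^(-1) Y^H) is a Lyapunov function by the Riccati equation. This avoids both the Jordan form
   of Gamma and the Hurwitz criterion. *)
theory Submission
  imports Defs "HOL-Computational_Algebra.Fundamental_Theorem_Algebra"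
begin

text \<open>With states stored as rows, the dynamics act by right multiplication and the coupling by
  left multiplication. The two commute, so q(Gamma) E solves the same equation as E, and a Kronecker
  product appears only in the formula for xbar. Eigenvalues may be nonreal, hence the passage to
  complex matrices. The inner product stays the real one, Re tr(X Y^H); multiplication by i is skew
  for it, so only Re l enters the estimates. The obstacle is that Gamma need not be diagonalizable,
  so E does not split into eigencomponents. Peeling a factor gives an equation that is closed up to
  a forcing term known only to tend to zero, without a rate, and the Lyapunov estimate tolerates
  exactly that. Repeated roots are therefore harmless. Any nonzero annihilating polynomial will do,
  since a root outside the spectrum falls under the injective alternative. The gain max{1, 1/delta}
  gives mu * Re l <= -1; the estimate asks for -1/2, the point at which the feedback compensates the
  term P B B^T P of the Riccati equation.\<close>

abbreviation cmat :: "real^'n^'m \<Rightarrow> complex^'n^'m" where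
  "cmat \<equiv> map_matrix complex_of_real"

section \<open>Matrix multiplication and the embedding of real matrices\<close>

lemma bounded_bilinear_matrix_matrix_mult:
  "bounded_bilinear ((**) :: 'a::{euclidean_space,real_normed_field}^'n^'m \<Rightarrow> 'a^'k^'n \<Rightarrow> 'a^'k^'m)"
  by (subst bilinear_conv_bounded_bilinear [symmetric])
     (auto simp: bilinear_def linear_iff matrix_matrix_mult_def vec_eq_iff ring_distribs
        sum.distrib scaleR_sum_right)

lemma matrix_norm_mult_bound:
  obtains K where "0 < K"
    "\<And>(X :: 'a::{euclidean_space,real_normed_field}^'n^'m) (Y :: 'a^'k^'n).
       norm (X ** Y) \<le> norm X * norm Y * K"
  using bounded_bilinear.pos_bounded[OF bounded_bilinear_matrix_matrix_mult] by metis

lemmas has_vector_derivative_matrix_mult_left =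
  bounded_linear.has_vector_derivative
    [OF bounded_bilinear.bounded_linear_left[OF bounded_bilinear_matrix_matrix_mult]]
lemmas has_vector_derivative_matrix_mult_right =
  bounded_linear.has_vector_derivative
    [OF bounded_bilinear.bounded_linear_right[OF bounded_bilinear_matrix_matrix_mult]]
lemmas tendsto_matrix_mult =
  bounded_bilinear.tendsto[OF bounded_bilinear_matrix_matrix_mult]

lemma matrix_add_rdistrib: "(A + B) ** C = A ** C + B ** (C :: 'a::semiring_1^'n^'m)"
  by (simp add: matrix_matrix_mult_def vec_eq_iff distrib_right sum.distrib)

lemma matrix_diff_ldistrib: "A ** (B - C) = A ** B - A ** (C :: 'a::ring_1^'n^'m)"
  by (simp add: matrix_matrix_mult_def vec_eq_iff right_diff_distrib sum_subtractf)

lemma matrix_diff_rdistrib: "(A - B) ** C = A ** C - B ** (C :: 'a::ring_1^'n^'m)"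
  by (simp add: matrix_matrix_mult_def vec_eq_iff left_diff_distrib sum_subtractf)

lemma matrix_mult_scaleR_left: "(k *\<^sub>R A) ** B = k *\<^sub>R (A ** (B :: 'a::real_algebra_1^'n^'m))"
  by (rule scalar_matrix_assoc [symmetric])

lemma matrix_mult_scaleR_right: "A ** (k *\<^sub>R B) = k *\<^sub>R (A ** (B :: 'a::real_algebra_1^'n^'m))"
  by (simp add: matrix_scalar_ac scalar_matrix_assoc)

lemma mat_matrix_mult_component: "(mat c ** X) $ i $ j = c * X $ i $ j"
  by (simp add: matrix_matrix_mult_def mat_def if_distrib[of "\<lambda>a. a * _"] cong: if_cong)

lemma matrix_mult_mat_component: "(X ** mat c) $ i $ j = X $ i $ j * c"
  by (simp add: matrix_matrix_mult_def mat_def if_distrib[of "\<lambda>a. _ * a"] cong: if_cong)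

lemma mat_mult_commute: "mat c ** X = X ** mat (c :: 'a::comm_semiring_1)"
  by (simp add: vec_eq_iff mat_matrix_mult_component matrix_mult_mat_component mult.commute)

lemma mat_mult_mat: "mat a ** mat b = (mat (a * b) :: 'a::semiring_1^'n^'n)"
  by (simp add: vec_eq_iff mat_matrix_mult_component) (simp add: mat_def)

lemma mat_of_real_mult: "mat (of_real c :: 'a) ** X = c *\<^sub>R (X :: 'a::real_algebra_1^'n^'m)"
  by (simp add: vec_eq_iff mat_matrix_mult_component scaleR_conv_of_real[where 'a='a])

lemma cmat_mult: "cmat (M ** N) = cmat M ** cmat N"
  by (simp add: vec_eq_iff matrix_matrix_mult_def)

lemma cmat_diff: "cmat (M - N) = cmat M - cmat N"
  by (simp add: vec_eq_iff)

lemma cmat_add: "cmat (M + N) = cmat M + cmat N"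
  by (simp add: vec_eq_iff)

lemma cmat_mat: "cmat (mat c) = mat (complex_of_real c)"
  by (simp add: vec_eq_iff mat_def)

lemma cmat_scaleR: "cmat (c *\<^sub>R M) = c *\<^sub>R cmat M"
  by (simp add: vec_eq_iff scaleR_conv_of_real[where 'a=complex])

section \<open>The real inner product Re tr(X Y^H) on complex matrices\<close>

lemma inner_complex_matrix: "inner X Y = (\<Sum>i\<in>UNIV. \<Sum>j\<in>UNIV. Re (X $ i $ j * cnj (Y $ i $ j)))"
  for X Y :: "complex^'n^'m"
  by (simp add: inner_vec_def inner_complex_def)

lemma inner_cmat_mult_right:
  "inner (X ** cmat M) Y = inner X (Y ** cmat (transpose M))" for X Y :: "complex^_^_"
proof -
  have "inner (X ** cmat M) Y =
     (\<Sum>i\<in>UNIV. \<Sum>j\<in>UNIV. \<Sum>k\<in>UNIV. Re (X $ i $ k * of_real (M $ k $ j) * cnj (Y $ i $ j)))"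
    by (simp add: inner_complex_matrix matrix_matrix_mult_def sum_distrib_right del: complex_cnj_mult times_complex.simps)
  also have "\<dots> = (\<Sum>i\<in>UNIV. \<Sum>k\<in>UNIV. \<Sum>j\<in>UNIV. Re (X $ i $ k * of_real (M $ k $ j) * cnj (Y $ i $ j)))"
    by (intro sum.cong refl sum.swap)
  also have "\<dots> = inner X (Y ** cmat (transpose M))"
    by (simp add: inner_complex_matrix matrix_matrix_mult_def sum_distrib_left transpose_def mult_ac
        del: times_complex.simps)
  finally show ?thesis .
qed

text \<open>The imaginary part of \<open>c\<close> acts as a skew map for the real inner product and
  contributes nothing. This is how a complex eigenvalue enters the energy estimate through its real
  part alone.\<close>

lemma inner_mat_mult_self: "inner (mat c ** X) X = Re c * (norm X)\<^sup>2" for X :: "complex^'n^'m"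
proof -
  have *: "Re (c * x * cnj x) = Re c * Re (x * cnj x)" for x
    by (simp add: algebra_simps)
  show ?thesis
    by (simp add: power2_norm_eq_inner inner_complex_matrix mat_matrix_mult_component
        sum_distrib_left * del: times_complex.simps)
qed

text \<open>Each row of \<open>W\<close> splits into real vectors \<open>a i\<close> and
  \<open>b i\<close>; the mixed terms are purely imaginary and vanish under \<open>Re\<close>,
  leaving two real quadratic forms per row.\<close>

lemma sym_pos_def_inner_cmat_pos:
  fixes P :: "real^'n^'n" and W :: "complex^'n^'p"
  assumes "sym_pos_def P" "W \<noteq> 0"
  shows "inner (W ** cmat P) W > 0"
proof -
  define a where "a i = (\<chi> j. Re (W $ i $ j))" for i
  define b where "b i = (\<chi> j. Im (W $ i $ j))" for i
  have sym: "P $ i $ j = P $ j $ i" for i j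
    using assms(1) unfolding sym_pos_def_def transpose_def by (metis vec_lambda_beta)
  have q: "v \<bullet> (P *v v) \<ge> 0" "v \<bullet> (P *v v) = 0 \<longleftrightarrow> v = 0" for v
    using assms(1) unfolding sym_pos_def_def
    by (cases "v = 0"; force intro: less_imp_le)+
  have eq: "inner (W ** cmat P) W = (\<Sum>i\<in>UNIV. a i \<bullet> (P *v a i) + b i \<bullet> (P *v b i))"
    by (simp add: inner_complex_matrix matrix_matrix_mult_def matrix_vector_mult_def inner_vec_def
        a_def b_def sum_distrib_left sum_distrib_right sum.distrib [symmetric] sym mult_ac Re_sum Im_sum)
  obtain i where "W $ i \<noteq> 0"
    using assms(2) by (metis vec_eq_iff zero_index)
  then have "a i \<noteq> 0 \<or> b i \<noteq> 0"
    by (auto simp: a_def b_def vec_eq_iff complex_eq_iff)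
  then have "a i \<bullet> (P *v a i) + b i \<bullet> (P *v b i) > 0"
    using q(1)[of "a i"] q(1)[of "b i"] q(2)[of "a i"] q(2)[of "b i"] by linarith
  then show ?thesis
    unfolding eq by (intro sum_pos2[of _ i]) (auto simp: q(1))
qed

text \<open>The minimum on the unit sphere exists by compactness and extends to all \<open>W\<close>
  by homogeneity of degree two. The bound serves to conclude from the decay of the Lyapunov function
  that the state itself decays.\<close>

lemma sym_pos_def_inner_cmat_bound:
  fixes P :: "real^'n^'n"
  assumes "sym_pos_def P"
  obtains c where "c > 0" "\<And>W :: complex^'n^'p. inner (W ** cmat P) W \<ge> c * (norm W)\<^sup>2"
proof -
  let ?f = "\<lambda>W :: complex^'n^'p. inner (W ** cmat P) W"
  have cont: "continuous_on (sphere 0 1) ?f"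
    by (intro continuous_intros bounded_linear.continuous_on
          [OF bounded_bilinear.bounded_linear_left[OF bounded_bilinear_matrix_matrix_mult]])
  obtain B :: "complex^'n^'p" where "B \<in> Basis"
    using nonempty_Basis by blast
  then have "sphere (0 :: complex^'n^'p) 1 \<noteq> {}"
    by (auto intro!: exI[of _ B])
  then obtain W0 where W0: "W0 \<in> sphere 0 1" "\<And>W. W \<in> sphere 0 1 \<Longrightarrow> ?f W0 \<le> ?f W"
    using continuous_attains_inf[OF compact_sphere _ cont] by blast
  show thesis
  proof
    show "?f W0 > 0"
      using W0(1) by (intro sym_pos_def_inner_cmat_pos assms) auto
    show "?f W \<ge> ?f W0 * (norm W)\<^sup>2" for W
    proof (cases "W = 0")
      case False
      then have "?f W0 \<le> ?f ((1 / norm W) *\<^sub>R W)"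
        by (intro W0(2)) simp
      also have "\<dots> = ?f W / (norm W)\<^sup>2"
        by (simp add: scalar_matrix_assoc [symmetric] power2_eq_square)
      finally show ?thesis
        using False by (simp add: field_simps)
    qed auto
  qed
qed

text \<open>A Gronwall estimate for forcing that vanishes at no particular rate: once
  \<open>h\<close> stays below \<open>c * d\<close>, the integrating factor
  \<open>exp (c * t)\<close> makes \<open>V - d\<close> bounded by a decaying exponential, and
  \<open>d\<close> is arbitrary.\<close>

lemma tendsto_zero_of_deriv_le:
  fixes V V' h :: "real \<Rightarrow> real"
  assumes c: "c > 0"
    and V: "\<And>t. t > 0 \<Longrightarrow> (V has_real_derivative V' t) (at t)"
    and le: "\<And>t. t > 0 \<Longrightarrow> V' t \<le> - c * V t + h t"
    and h: "(h \<longlongrightarrow> 0) at_top"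
    and nonneg: "\<And>t. t > 0 \<Longrightarrow> V t \<ge> 0"
  shows "(V \<longlongrightarrow> 0) at_top"
proof (rule tendstoI)
  fix e :: real assume e: "e > 0"
  \<comment> \<open>Half of \<open>e\<close> is the level forced by \<open>h\<close>; the other half
    is left for the exponential.\<close>
  define d where "d = e / 2"
  have d: "d > 0" using e by (simp add: d_def)
  have "eventually (\<lambda>t. h t < c * d) at_top"
    using h c d by (intro order_tendstoD) auto
  then obtain T0 where T0: "\<And>t. t \<ge> T0 \<Longrightarrow> h t < c * d"
    unfolding eventually_at_top_linorder by auto
  \<comment> \<open>The maximum with 1 keeps \<open>T\<close> inside the open half-line where the
    derivative is given.\<close>
  define T where "T = max T0 1"
  have T: "T > 0" "\<And>t. t \<ge> T \<Longrightarrow> h t < c * d"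
    using T0 by (auto simp: T_def)
  have bound: "V t \<le> d + (V T - d) * exp (- c * (t - T))" if "t \<ge> T" for t
  proof -
    have "(V t - d) * exp (c * t) \<le> (V T - d) * exp (c * T)"
    proof (rule DERIV_nonpos_imp_nonincreasing[OF that])
      fix s assume s: "T \<le> s" "s \<le> t"
      have "((\<lambda>s. (V s - d) * exp (c * s)) has_real_derivative
              (V' s + c * (V s - d)) * exp (c * s)) (at s)"
        using s T(1) by (auto intro!: derivative_eq_intros V simp: algebra_simps)
      moreover have "(V' s + c * (V s - d)) * exp (c * s) \<le> 0"
        using le[of s] T(2)[of s] T(1) s
        by (intro mult_nonpos_nonneg) (auto simp: algebra_simps)
      ultimately show "\<exists>y. ((\<lambda>s. (V s - d) * exp (c * s)) has_real_derivative y) (at s) \<and> y \<le> 0"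
        by blast
    qed
    then have "(V t - d) * exp (c * t) * exp (- c * t) \<le> (V T - d) * exp (c * T) * exp (- c * t)"
      by (intro mult_right_mono) auto
    then show ?thesis
      by (simp add: mult.assoc exp_add [symmetric] algebra_simps)
  qed
  have "((\<lambda>t. d + (V T - d) * exp (- c * (t - T))) \<longlongrightarrow> d + (V T - d) * 0) at_top"
  proof (intro tendsto_intros filterlim_compose[OF exp_at_bot])
    have "filterlim (\<lambda>t. c * (t - T)) at_top at_top"
      using filterlim_tendsto_add_at_top[OF tendsto_const filterlim_ident, of "- T"]
      by (intro filterlim_tendsto_pos_mult_at_top[OF tendsto_const c]) (simp add: algebra_simps)
    then show "filterlim (\<lambda>t. - c * (t - T)) at_bot at_top"
      by (simp add: filterlim_uminus_at_bot)
  qed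
  then have "eventually (\<lambda>t. d + (V T - d) * exp (- c * (t - T)) < e) at_top"
    by (rule order_tendstoD(2)) (use e in \<open>auto simp: d_def\<close>)
  then show "eventually (\<lambda>t. dist (V t) 0 < e) at_top"
    using eventually_ge_at_top[of T]
  proof eventually_elim
    case (elim t)
    then show ?case using bound[of t] nonneg[of t] T(1) by auto
  qed
qed

section \<open>Polynomials of a matrix\<close>

text \<open>Horner's scheme with the product \<open>**\<close> and scalars embedded by
  \<open>mat\<close>; the multiplication of the vector type, being componentwise, would give another
  object.\<close>

definition matrix_poly :: "'a::comm_ring_1^'n^'n \<Rightarrow> 'a poly \<Rightarrow> 'a^'n^'n" where
  "matrix_poly M q = fold_coeffs (\<lambda>a N. mat a + M ** N) q 0"

lemma matrix_poly_0 [simp]: "matrix_poly M 0 = 0"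
  by (simp add: matrix_poly_def)

lemma matrix_poly_pCons [simp]: "matrix_poly M (pCons a q) = mat a + M ** matrix_poly M q"
  by (cases "a = 0 \<and> q = 0") (auto simp: matrix_poly_def)

lemma mat_add: "mat (a + b) = mat a + (mat b :: 'a::comm_ring_1^'n^'n)"
  by (simp add: mat_def vec_eq_iff)

lemma matrix_poly_add: "matrix_poly M (p + q) = matrix_poly M p + matrix_poly M q"
  by (induction p q rule: poly_induct2) (simp_all add: mat_add matrix_add_ldistrib)

lemma matrix_poly_smult:
  fixes M :: "'a::comm_ring_1^'n^'n"
  shows "matrix_poly M (smult c q) = mat c ** matrix_poly M q"
proof (induction q)
  case (pCons a q)
  have "M ** (mat c ** N) = mat c ** (M ** N)" for N :: "'a^'n^'n"
    by (simp only: mat_mult_commute[of c M] matrix_mul_assoc)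
  then show ?case using pCons by (simp add: mat_mult_mat matrix_add_ldistrib)
qed simp

lemma matrix_poly_sum: "matrix_poly M (sum f I) = (\<Sum>i\<in>I. matrix_poly M (f i))"
  by (induction I rule: infinite_finite_induct) (simp_all add: matrix_poly_add)

lemma matrix_poly_linear_factor:
  fixes M :: "'a::comm_ring_1^'n^'n"
  shows "matrix_poly M ([:- c, 1:] * q) = (M - mat c) ** matrix_poly M q"
proof -
  have "mat (- c) ** N = - (mat c ** N)" for N :: "'a^'n^'n"
    by (simp add: vec_eq_iff mat_matrix_mult_component)
  then show ?thesis
    by (simp add: matrix_poly_add matrix_poly_smult matrix_diff_rdistrib del: smult_minus_left)
qed

lemma matrix_poly_commute: "M ** matrix_poly M q = matrix_poly M q ** M"
proof (induction q)
  case (pCons a q)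
  have "M ** (M ** matrix_poly M q) = M ** (matrix_poly M q ** M)"
    using pCons by simp
  also have "\<dots> = M ** matrix_poly M q ** M"
    by (rule matrix_mul_assoc)
  finally have "M ** (M ** matrix_poly M q) = M ** matrix_poly M q ** M" .
  then show ?case
    by (simp add: matrix_add_ldistrib matrix_add_rdistrib mat_mult_commute)
qed simp

lemma matrix_poly_eigenvector:
  fixes M :: "'a::field^'n^'n"
  assumes "M *v v = c *s v"
  shows "matrix_poly M q *v v = poly q c *s v"
proof (induction q)
  case (pCons a q)
  have "mat a *v v = a *s v"
    by (simp add: vec_eq_iff matrix_vector_mult_def mat_def if_distrib[of "\<lambda>a. a * _"] cong: if_cong)
  then show ?case
    using pCons assms
    by (simp add: matrix_vector_mult_add_rdistrib matrix_vector_mul_assoc [symmetric]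
        vector_scalar_commute vector_sadd_rdistrib vector_smult_assoc mult.commute)
qed simp

text \<open>The matrices of this size form a real vector space of finite dimension \<open>N\<close>,
  so the \<open>N + 1\<close> powers with exponents up to \<open>N\<close> satisfy a linear
  relation, whose coefficients can be taken real.\<close>

lemma annihilating_polynomial:
  fixes M :: "complex^'n^'n"
  obtains q where "q \<noteq> 0" "matrix_poly M q = 0"
proof -
  define N where "N = DIM(complex^'n^'n)"
  define f where "f k = matrix_poly M (monom 1 k)" for k
  show thesis
  \<comment> \<open>Linear dependence is a property of the set of powers, so coinciding powers are
    treated apart: there the difference of two monomials annihilates \<open>M\<close>.\<close>
  proof (cases "inj_on f {..N}")
    case False
    then obtain i j where ij: "i \<noteq> j" "f i = f j" unfolding inj_on_def by blast
    have "matrix_poly M (monom 1 i + smult (- 1) (monom 1 j)) = f i + mat (- 1) ** f j"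
      unfolding matrix_poly_add matrix_poly_smult f_def ..
    also have "\<dots> = 0" using ij by (simp add: vec_eq_iff mat_matrix_mult_component)
    finally have "matrix_poly M (monom 1 i + smult (- 1) (monom 1 j)) = 0" .
    moreover have "coeff (monom 1 i + smult (- 1) (monom 1 j) :: complex poly) i \<noteq> 0"
      using ij(1) by simp
    ultimately show thesis using that by (metis coeff_0)
  next
    case True
    then have "card (f ` {..N}) > N" by (simp add: card_image)
    then have "dependent (f ` {..N})" unfolding N_def by (intro dependent_biggerset) auto
    then obtain u where u: "\<exists>v\<in>f ` {..N}. u v \<noteq> 0" "(\<Sum>v\<in>f ` {..N}. u v *\<^sub>R v) = 0"
      by (auto simp: dependent_finite)
    define q where "q = (\<Sum>k\<le>N. smult (of_real (u (f k))) (monom 1 k) :: complex poly)"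
    have "matrix_poly M q = (\<Sum>k\<le>N. u (f k) *\<^sub>R f k)"
      unfolding q_def matrix_poly_sum matrix_poly_smult f_def mat_of_real_mult ..
    also have "\<dots> = 0" using u(2) True by (simp add: sum.reindex)
    finally have q0: "matrix_poly M q = 0" .
    have cf: "coeff q k = of_real (u (f k))" if "k \<le> N" for k
      using that by (simp add: q_def coeff_sum if_distrib[of "\<lambda>x. _ * x"] cong: if_cong)
    obtain k where "k \<le> N" "u (f k) \<noteq> 0" using u(1) by blast
    then have "q \<noteq> 0" using cf[of k] by auto
    then show thesis using that q0 by blast
  qed
qed

section \<open>Eigenvalues and kernel of a connected matrix\<close>

text \<open>Applied to an eigenvector, an annihilating polynomial shows that its eigenvalue is one
  of its roots.\<close>

lemma finite_eigenvalues: "finite {l. is_eigenvalue M l}"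
proof -
  obtain q where q: "q \<noteq> 0" "matrix_poly M q = 0" using annihilating_polynomial .
  have "{l. is_eigenvalue M l} \<subseteq> {l. poly q l = 0}"
    using matrix_poly_eigenvector[of M _ _ q] q(2)
    by (force simp: is_eigenvalue_def vec_eq_iff)
  then show ?thesis using poly_roots_finite[OF q(1)] finite_subset by blast
qed

text \<open>Since \<open>is_lambda2\<close> is a relation, a bound on everything it relates says
  something only if something is related. Finiteness of the spectrum supplies a minimizer as soon as
  one nonzero eigenvalue exists.\<close>

lemma eigenvalue_Re_le_of_lambda2:
  fixes M :: "real^'p^'p"
  assumes "is_eigenvalue (cmat M) k" "k \<noteq> 0"
  obtains l where "is_lambda2 M l" "\<bar>Re l\<bar> \<le> \<bar>Re k\<bar>"
proof -
  let ?E = "{k. is_eigenvalue (cmat M) k \<and> k \<noteq> 0}"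
  have fin: "finite ?E"
    using finite_eigenvalues[of "cmat M"] by (rule rev_finite_subset) auto
  obtain l where "is_arg_min (\<lambda>k. \<bar>Re k\<bar>) (\<lambda>k. k \<in> ?E) l"
    using ex_is_arg_min_if_finite[OF fin] assms by blast
  then show thesis
    using that[of l] assms by (auto simp: is_arg_min_linorder is_lambda2_def)
qed

text \<open>Gershgorin's argument: zero row sums give row \<open>i\<close> a disc with centre
  \<open>G $ i $ i\<close> and radius \<open>- G $ i $ i\<close>, which lies in the closed left
  half-plane. The row is one where the eigenvector has an entry of maximal modulus.\<close>

lemma zero_row_sum_eigenvalue_Re_le:
  fixes G :: "real^'p^'p"
  assumes nonneg: "\<And>i j. i \<noteq> j \<Longrightarrow> G $ i $ j \<ge> 0"
    and rows: "\<And>i. (\<Sum>j\<in>UNIV. G $ i $ j) = 0"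
    and "is_eigenvalue (cmat G) l"
  shows "Re l \<le> 0"
proof -
  obtain v where v: "v \<noteq> 0" "cmat G *v v = l *s v"
    using assms(3) unfolding is_eigenvalue_def by blast
  obtain i where i: "\<And>j. norm (v $ j) \<le> norm (v $ i)"
    using Max_in[of "range (\<lambda>j. norm (v $ j))"] Max_ge[of "range (\<lambda>j. norm (v $ j))"] by fastforce
  have pos: "norm (v $ i) > 0"
  proof (rule ccontr)
    assume "\<not> ?thesis"
    then have "v $ j = 0" for j using i[of j] by simp
    then show False using v(1) by (simp add: vec_eq_iff)
  qed
  have "l * v $ i = (\<Sum>j\<in>UNIV. G $ i $ j * v $ j)"
    using v(2) by (simp add: vec_eq_iff matrix_vector_mult_def)
  also have "\<dots> = G $ i $ i * v $ i + (\<Sum>j\<in>UNIV - {i}. G $ i $ j * v $ j)"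
    by (simp add: sum.remove)
  finally have eq: "(l - G $ i $ i) * v $ i = (\<Sum>j\<in>UNIV - {i}. G $ i $ j * v $ j)"
    by (simp add: algebra_simps)
  have "norm (l - G $ i $ i) * norm (v $ i) \<le> (\<Sum>j\<in>UNIV - {i}. norm (G $ i $ j * v $ j))"
    unfolding norm_mult [symmetric] eq by (rule norm_sum)
  also have "\<dots> \<le> (\<Sum>j\<in>UNIV - {i}. G $ i $ j * norm (v $ i))"
    using nonneg i by (intro sum_mono) (auto simp: norm_mult intro!: mult_mono)
  also have "\<dots> = - G $ i $ i * norm (v $ i)"
  proof -
    have "(\<Sum>j\<in>UNIV - {i}. G $ i $ j) = - G $ i $ i"
      using rows[of i] by (simp add: sum.remove[of UNIV i])
    then show ?thesis by (simp add: sum_distrib_right [symmetric])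
  qed
  finally have "norm (l - G $ i $ i) \<le> - G $ i $ i"
    by (rule mult_right_le_imp_le[OF _ pos])
  then show ?thesis
    using complex_Re_le_cmod[of "l - G $ i $ i"] by simp
qed

text \<open>A maximum principle: where \<open>v\<close> is maximal, the row equation is a vanishing
  sum of nonnegative terms, so every out-neighbour is maximal too. Paths carry the maximum from
  \<open>i\<close> to the root \<open>c\<close>.\<close>

lemma connected_matrix_kernel_le:
  fixes G :: "real^'p^'p"
  assumes nonneg: "\<And>i j. i \<noteq> j \<Longrightarrow> G $ i $ j \<ge> 0"
    and rows: "\<And>i. (\<Sum>j\<in>UNIV. G $ i $ j) = 0"
    and root: "\<And>i. i \<noteq> c \<Longrightarrow> \<exists>ns. is_path (graph_of_matrix G) i ns c"
    and ker: "G *v v = 0"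
  shows "v $ k \<le> v $ c"
proof -
  obtain i where i: "\<And>j. v $ j \<le> v $ i"
    using Max_in[of "range (\<lambda>j. v $ j)"] Max_ge[of "range (\<lambda>j. v $ j)"] by fastforce
  have step: "v $ b = v $ i" if "v $ a = v $ i" "G $ a $ b > 0" for a b
  proof -
    have "(\<Sum>j\<in>UNIV. G $ a $ j * v $ j) = 0"
      using ker by (simp add: vec_eq_iff matrix_vector_mult_def)
    moreover have "(\<Sum>j\<in>UNIV. G $ a $ j * v $ i) = 0"
      using rows[of a] by (simp add: sum_distrib_right [symmetric])
    ultimately have "(\<Sum>j\<in>UNIV. G $ a $ j * (v $ i - v $ j)) = 0"
      by (simp add: right_diff_distrib sum_subtractf)
    moreover have "G $ a $ j * (v $ i - v $ j) \<ge> 0" for j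
      using nonneg[of a j] i[of j] that(1) by (cases "a = j") auto
    ultimately have "G $ a $ b * (v $ i - v $ b) = 0"
      by (subst (asm) sum_nonneg_eq_0_iff) auto
    then show ?thesis using that by simp
  qed
  have path: "v $ last ns = v $ i"
    if "ns \<noteq> []" "successively (\<lambda>a b. (a, b) \<in> snd (graph_of_matrix G)) ns" "v $ hd ns = v $ i" for ns
    using that
  proof (induction ns)
    case (Cons a ns)
    then show ?case
      using step[of a "hd ns"] by (cases ns) (auto simp: graph_of_matrix_def)
  qed simp
  have "v $ c = v $ i"
  proof (cases "i = c")
    case False
    then obtain ns where "is_path (graph_of_matrix G) i ns c" using root by blast
    then show ?thesis using path[of ns] by (simp add: is_path_def)
  qed simp
  then show ?thesis using i[of k] by simp
qed

lemma connected_matrix_kernel: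
  fixes G :: "real^'p^'p"
  assumes "connected_matrix G" "cmat G *v w = 0"
  obtains c where "\<And>i. w $ i = c"
proof -
  have nonneg: "\<And>i j. i \<noteq> j \<Longrightarrow> G $ i $ j \<ge> 0" and rows: "\<And>i. (\<Sum>j\<in>UNIV. G $ i $ j) = 0"
    using assms(1) by (auto simp: connected_matrix_def)
  obtain c where c: "\<forall>u \<in> fst (graph_of_matrix G) - {c}. \<exists>ns. is_path (graph_of_matrix G) u ns c"
    using assms(1) unfolding connected_matrix_def connected_graph_def by metis
  have root: "\<exists>ns. is_path (graph_of_matrix G) i ns c" if "i \<noteq> c" for i
    using c that by (simp add: graph_of_matrix_def)
  have eq: "v $ k = v $ c" if "G *v v = 0" for v k
  proof -
    \<comment> \<open>The maximum principle for \<open>- v\<close> gives the reverse inequality, so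
      \<open>v\<close> is constant.\<close>
    have neg: "G *v (- v) = 0"
      using that by (simp add: vec_eq_iff matrix_vector_mult_def sum_negf)
    then show ?thesis
      using connected_matrix_kernel_le[OF nonneg rows root that, of k]
        connected_matrix_kernel_le[OF nonneg rows root neg, of k] by simp
  qed
  have "G *v (\<chi> i. Re (w $ i)) = 0" "G *v (\<chi> i. Im (w $ i)) = 0"
    using assms(2) by (simp_all add: vec_eq_iff complex_eq_iff matrix_vector_mult_def)
  then have "w $ i = w $ c" for i
    using eq[of "\<chi> i. Re (w $ i)" i] eq[of "\<chi> i. Im (w $ i)" i] by (simp add: complex_eq_iff)
  then show thesis using that by blast
qed

section \<open>The Lyapunov estimate from the Riccati equation\<close>

lemma sym_pos_def_inverse:
  assumes "sym_pos_def P"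
  obtains Q where "P ** Q = mat 1" "Q ** P = mat 1" "transpose Q = Q"
proof -
  have "P *v v = 0 \<Longrightarrow> v = 0" for v
    using assms unfolding sym_pos_def_def by (metis inner_zero_right less_irrefl)
  then obtain Q where Q: "Q ** P = mat 1"
    using matrix_left_invertible_ker[of P] by blast
  then have PQ: "P ** Q = mat 1" by (simp add: matrix_left_right_inverse)
  have "transpose Q ** P = mat 1"
    using arg_cong[OF PQ, of transpose] assms by (simp add: matrix_transpose_mul sym_pos_def_def)
  then have "transpose Q = Q"
    by (metis PQ matrix_mul_assoc matrix_mul_lid matrix_mul_rid)
  then show thesis using that Q PQ by blast
qed

text \<open>Doubling the form leaves only the symmetric part of \<open>P ** A\<close>, and the
  Riccati equation replaces \<open>P ** A + transpose A ** P\<close> by a Gram-type term minus the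
  identity; both become squared norms.\<close>

lemma riccati_inner:
  fixes A P :: "real^'n^'n" and B :: "real^'m^'n" and W :: "complex^'n^'p"
  assumes sym: "transpose P = P"
    and ric: "transpose A ** P + P ** A + mat 1 - P ** B ** transpose B ** P = 0"
  shows "2 * inner (W ** cmat P ** cmat A) W = (norm (W ** cmat P ** cmat B))\<^sup>2 - (norm W)\<^sup>2"
proof -
  have eq: "P ** A + transpose A ** P = P ** B ** transpose B ** P - mat 1"
    using ric by (simp add: algebra_simps)
  have "2 * inner (W ** cmat P ** cmat A) W = inner (W ** cmat (P ** A)) W + inner W (W ** cmat (P ** A))"
    by (simp add: cmat_mult matrix_mul_assoc inner_commute)
  also have "inner W (W ** cmat (P ** A)) = inner (W ** cmat (transpose A ** P)) W"
    by (simp add: inner_cmat_mult_right matrix_transpose_mul sym)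
  also have "inner (W ** cmat (P ** A)) W + \<dots> = inner (W ** cmat (P ** A + transpose A ** P)) W"
    by (simp add: cmat_add matrix_add_ldistrib inner_add_left)
  also have "\<dots> = inner (W ** cmat P ** cmat B ** cmat (transpose B) ** cmat P) W - inner W W"
    unfolding eq by (simp add: cmat_diff cmat_mult cmat_mat matrix_diff_ldistrib inner_diff_left matrix_mul_assoc)
  also have "inner (W ** cmat P ** cmat B ** cmat (transpose B) ** cmat P) W
      = (norm (W ** cmat P ** cmat B))\<^sup>2"
    by (simp add: inner_cmat_mult_right sym power2_norm_eq_inner)
  finally show ?thesis by (simp add: power2_norm_eq_inner)
qed

text \<open>Along solutions the derivative of \<open>V\<close> is \<open>1 + 2 * Re c\<close> times
  the squared norm of \<open>Y t ** cmat B\<close>, minus the squared norm of \<open>W t\<close>,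
  plus forcing. The bound on \<open>Re c\<close> is the one that makes the first coefficient
  nonpositive; the second term drives the decay.\<close>

lemma riccati_feedback_tendsto_zero:
  fixes A P :: "real^'n^'n" and B :: "real^'m^'n" and Y H :: "real \<Rightarrow> complex^'n^'p"
  assumes P: "sym_pos_def P"
    and ric: "transpose A ** P + P ** A + mat 1 - P ** B ** transpose B ** P = 0"
    and c: "Re c \<le> - 1 / 2"
    and Y: "\<And>t. t > 0 \<Longrightarrow> (Y has_vector_derivative
         (Y t ** cmat A + mat c ** (Y t ** cmat (B ** transpose B ** P)) + H t)) (at t)"
    and H: "(H \<longlongrightarrow> 0) at_top"
  shows "(Y \<longlongrightarrow> 0) at_top"
proof -
  have sym: "transpose P = P" using P by (simp add: sym_pos_def_def)
  obtain Q where Q: "P ** Q = mat 1" "Q ** P = mat 1" "transpose Q = Q"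
    using sym_pos_def_inverse[OF P] .
  have cQ: "cmat Q ** cmat P = mat 1" "cmat P ** cmat Q = mat 1"
    using Q by (simp_all add: cmat_mult [symmetric] cmat_mat)
  \<comment> \<open>In terms of \<open>W\<close>, which is Y P^(-1), the drift
    \<open>Y t ** cmat A\<close> becomes \<open>W t ** cmat P ** cmat A\<close>, the form covered by
    the Riccati identity.\<close>
  define W where "W t = Y t ** cmat Q" for t
  have WP: "W t ** cmat P = Y t" for t
    by (simp add: W_def matrix_mul_assoc [symmetric] cQ)
  define D where "D t = Y t ** cmat A + mat c ** (Y t ** cmat (B ** transpose B ** P)) + H t" for t
  define V where "V t = inner (Y t) (W t)" for t
  obtain K where K: "K > 0" "\<And>(X :: complex^'n^'p) (Z :: complex^'n^'n). norm (X ** Z) \<le> norm X * norm Z * K"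
    using matrix_norm_mult_bound by blast
  \<comment> \<open>The summand 1 secures positivity, as \<open>k\<close> is divided by
    below.\<close>
  define k where "k = norm (cmat P) * K + 1"
  have k: "k > 0" using K(1) by (simp add: k_def add_nonneg_pos)
  obtain m where m: "m > 0" "\<And>W :: complex^'n^'p. inner (W ** cmat P) W \<ge> m * (norm W)\<^sup>2"
    using sym_pos_def_inner_cmat_bound[OF P] by blast
  have V_le: "V t \<le> k * (norm (W t))\<^sup>2" for t
  proof -
    have "V t \<le> norm (Y t) * norm (W t)"
      unfolding V_def by (rule norm_cauchy_schwarz)
    also have "\<dots> \<le> (norm (W t) * norm (cmat P) * K) * norm (W t)"
      using K(2)[of "W t" "cmat P"] by (intro mult_right_mono) (simp_all add: WP)
    also have "\<dots> \<le> k * (norm (W t))\<^sup>2"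
      by (simp add: k_def power2_eq_square algebra_simps)
    finally show ?thesis .
  qed
  have V_ge: "V t \<ge> m * (norm (W t))\<^sup>2" for t
    using m(2)[of "W t"] by (simp add: V_def WP)
  have DW: "2 * inner (D t) (W t) \<le> - (1 / (2 * k)) * V t + 2 * (norm (H t))\<^sup>2" for t
  proof -
    have "inner (mat c ** (Y t ** cmat (B ** transpose B ** P))) (W t)
        = inner (mat c ** (Y t ** cmat B)) (Y t ** cmat B)"
    proof -
      have "mat c ** (Y t ** cmat (B ** transpose B ** P))
          = mat c ** (Y t ** cmat B) ** cmat (transpose B) ** cmat P"
        by (simp add: cmat_mult matrix_mul_assoc)
      then show ?thesis by (simp add: inner_cmat_mult_right sym WP)
    qed
    then have "2 * inner (D t) (W t) =
        2 * inner (W t ** cmat P ** cmat A) (W t) + 2 * (Re c * (norm (Y t ** cmat B))\<^sup>2) + 2 * inner (H t) (W t)"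
      by (simp add: D_def inner_add_left inner_mat_mult_self WP)
    also have "\<dots> = (1 + 2 * Re c) * (norm (Y t ** cmat B))\<^sup>2 - (norm (W t))\<^sup>2 + 2 * inner (H t) (W t)"
      using riccati_inner[OF sym ric, of "W t"] by (simp add: WP algebra_simps)
    also have "\<dots> \<le> - (norm (W t))\<^sup>2 + 2 * (norm (H t) * norm (W t))"
    proof -
      have "(1 + 2 * Re c) * (norm (Y t ** cmat B))\<^sup>2 \<le> 0"
        using c by (intro mult_nonpos_nonneg) auto
      then show ?thesis using norm_cauchy_schwarz[of "H t" "W t"] by linarith
    qed
    \<comment> \<open>Young's inequality weighted to spend half of the decay term on the forcing,
      which leaves only a multiple of the squared norm of \<open>H t\<close>.\<close>
    also have "\<dots> \<le> - (1 / 2) * (norm (W t))\<^sup>2 + 2 * (norm (H t))\<^sup>2"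
      using zero_le_power2[of "norm (W t) - 2 * norm (H t)"]
      by (simp add: power2_eq_square algebra_simps)
    also have "\<dots> \<le> - (1 / (2 * k)) * V t + 2 * (norm (H t))\<^sup>2"
      using V_le[of t] k by (simp add: field_simps)
    finally show ?thesis .
  qed
  have V': "(V has_real_derivative 2 * inner (D t) (W t)) (at t)" if "t > 0" for t
  proof -
    have Y': "(Y has_vector_derivative D t) (at t)" using Y[OF that] by (simp add: D_def)
    have W': "(W has_vector_derivative D t ** cmat Q) (at t)"
      unfolding W_def by (intro has_vector_derivative_matrix_mult_left Y')
    have "(V has_vector_derivative inner (Y t) (D t ** cmat Q) + inner (D t) (W t)) (at t)"
      unfolding V_def by (rule bounded_bilinear.has_vector_derivative[OF bounded_bilinear_inner Y' W'])
    moreover have "inner (Y t) (D t ** cmat Q) = inner (D t) (W t)"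
      by (metis Q(3) W_def inner_cmat_mult_right inner_commute)
    ultimately show ?thesis by (simp add: has_real_derivative_iff_has_vector_derivative)
  qed
  have H2: "((\<lambda>t. 2 * (norm (H t))\<^sup>2) \<longlongrightarrow> 0) at_top"
    using H by (auto intro!: tendsto_eq_intros)
  have "(V \<longlongrightarrow> 0) at_top"
    by (rule tendsto_zero_of_deriv_le[where c = "1 / (2 * k)", OF _ V' DW H2])
       (use k m(1) in \<open>auto intro!: order_trans[OF _ V_ge]\<close>)
  then have Vm: "((\<lambda>t. V t / m) \<longlongrightarrow> 0) at_top"
    by (rule tendsto_divide_zero)
  have W_le: "(norm (W t))\<^sup>2 \<le> V t / m" for t
    using V_ge[of t] m(1) by (simp add: field_simps)
  have "((\<lambda>t. (norm (W t))\<^sup>2) \<longlongrightarrow> 0) at_top"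
    by (rule Lim_null_comparison[OF _ Vm]) (simp add: W_le)
  then have "(W \<longlongrightarrow> 0) at_top"
    using tendsto_real_sqrt[of "\<lambda>t. (norm (W t))\<^sup>2" 0] by (simp add: tendsto_norm_zero_iff)
  then have "((\<lambda>t. W t ** cmat P) \<longlongrightarrow> 0 ** cmat P) at_top"
    by (intro tendsto_matrix_mult tendsto_const)
  then show ?thesis by (simp add: WP)
qed

section \<open>Decay of the disagreement\<close>

text \<open>Every term of positive degree is killed by \<open>R ** M = 0\<close>. Hence applying a
  polynomial of the coupling matrix preserves the constraint that \<open>R\<close> annihilates the
  error.\<close>

lemma row_matrix_poly:
  fixes R :: "'a::comm_ring_1^'n^'m"
  assumes "R ** M = 0"
  shows "R ** matrix_poly M q = mat (coeff q 0) ** R"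
  by (cases q) (simp add: matrix_add_ldistrib matrix_mul_assoc assms mat_mult_commute)

lemma matrix_mult_column: "M *v column j X = column j (M ** X)"
  by (simp add: vec_eq_iff column_def matrix_vector_mult_def matrix_matrix_mult_def)

text \<open>The case distinction asks for an eigenvector inside the annihilator of \<open>R\<close>.
  This puts the eigenvalue 0 on the injective side: its eigenvectors are constant, and a nonzero
  constant vector is not annihilated because the entries of \<open>r\<close> sum to 1.\<close>

lemma consensus_factor:
  fixes A P :: "real^'n^'n" and B :: "real^'m^'n" and G :: "real^'p^'p" and r :: "real^'p"
    and Y :: "real \<Rightarrow> complex^'n^'p"
  defines "R \<equiv> cmat (rowvector r :: real^'p^1)"
  assumes P: "sym_pos_def P"
    and ric: "transpose A ** P + P ** A + mat 1 - P ** B ** transpose B ** P = 0"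
    and conn: "connected_matrix G"
    and r1: "r \<bullet> 1 = 1"
    and spec: "\<And>k. is_eigenvalue (cmat G) k \<Longrightarrow> k \<noteq> 0 \<Longrightarrow> \<mu> * Re k \<le> - 1 / 2"
    and Y: "\<And>t. t > 0 \<Longrightarrow> (Y has_vector_derivative
         (Y t ** cmat A + \<mu> *\<^sub>R (cmat G ** Y t ** cmat (B ** transpose B ** P)))) (at t)"
    and RY: "\<And>t. t > 0 \<Longrightarrow> R ** Y t = 0"
    and lim: "((\<lambda>t. (cmat G - mat l) ** Y t) \<longlongrightarrow> 0) at_top"
  shows "(Y \<longlongrightarrow> 0) at_top"
proof (cases "\<exists>v. v \<noteq> 0 \<and> R *v v = 0 \<and> cmat G *v v = l *s v")
  case False
  define S where "S = {Z :: complex^'n^'p. R ** Z = 0}"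
  \<comment> \<open>A nonzero column of \<open>Z\<close> would be an eigenvector of the excluded
    kind.\<close>
  have "Z = 0" if Z: "R ** Z = 0" "(cmat G - mat l) ** Z = 0" for Z :: "complex^'n^'p"
  proof -
    have "column j Z = 0" for j
    proof -
      have "R *v column j Z = 0"
        unfolding matrix_mult_column Z(1) by (simp add: vec_eq_iff column_def)
      moreover have "cmat G *v column j Z = l *s column j Z"
      proof -
        have "cmat G ** Z = mat l ** Z"
          using Z(2) by (simp add: matrix_diff_rdistrib)
        then show ?thesis
          unfolding matrix_mult_column by (simp add: vec_eq_iff column_def mat_matrix_mult_component)
      qed
      ultimately show ?thesis using False by blast
    qed
    then show ?thesis by (simp add: vec_eq_iff column_def)
  qed
  then have inj: "\<forall>Z\<in>S. (cmat G - mat l) ** Z = 0 \<longrightarrow> Z = 0"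
    by (simp add: S_def)
  have sub: "subspace S"
    unfolding S_def subspace_def by (auto simp: matrix_add_ldistrib matrix_mult_scaleR_right)
  \<comment> \<open>In finite dimension an injective linear map on a subspace is bounded below, so
    the limit passes from the image back to \<open>Y\<close>.\<close>
  obtain e where e: "e > 0" "\<forall>Z\<in>S. norm ((cmat G - mat l) ** Z) \<ge> e * norm Z"
    using injective_imp_isometric[where s = S and f = "\<lambda>Z. (cmat G - mat l) ** Z",
          OF closed_subspace[OF sub] sub
          bounded_bilinear.bounded_linear_right[OF bounded_bilinear_matrix_matrix_mult] inj] by metis
  have lim': "((\<lambda>t. norm ((cmat G - mat l) ** Y t) / e) \<longlongrightarrow> 0) at_top"
    by (rule tendsto_divide_zero[OF tendsto_norm_zero[OF lim]])
  have le: "norm (Y t) \<le> norm ((cmat G - mat l) ** Y t) / e" if "t > 0" for t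
    using e(1) bspec[OF e(2), of "Y t"] RY[OF that] by (simp add: S_def field_simps)
  have "eventually (\<lambda>t. norm (Y t) \<le> norm ((cmat G - mat l) ** Y t) / e) at_top"
    by (rule eventually_mono[OF eventually_gt_at_top[of 0] le])
  then show ?thesis by (rule Lim_null_comparison[OF _ lim'])
next
  case True
  then obtain v where v: "v \<noteq> 0" "R *v v = 0" "cmat G *v v = l *s v" by blast
  have "l \<noteq> 0"
  proof
    assume "l = 0"
    then obtain c where c: "\<And>i. v $ i = c" using connected_matrix_kernel[OF conn, of v] v(3) by auto
    have "(\<Sum>i\<in>UNIV. of_real (r $ i) * c) = 0"
      using v(2) by (simp add: R_def vec_eq_iff matrix_vector_mult_def rowvector_def c)
    moreover have "(\<Sum>i\<in>UNIV. of_real (r $ i) * c) = of_real (r \<bullet> 1) * c"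
      by (simp add: inner_vec_def sum_distrib_right)
    ultimately have "c = 0" using r1 by simp
    then show False using v(1) c by (simp add: vec_eq_iff)
  qed
  moreover have "is_eigenvalue (cmat G) l" using v by (auto simp: is_eigenvalue_def)
  ultimately have "Re (of_real \<mu> * l) \<le> - 1 / 2" using spec by simp
  then show ?thesis
  proof (rule riccati_feedback_tendsto_zero[OF P ric])
    let ?S = "cmat (B ** transpose B ** P)"
    \<comment> \<open>The error made by replacing \<open>cmat G\<close> by the scalar
      \<open>l\<close> in the coupling term; it vanishes in the limit by \<open>lim\<close>.\<close>
    let ?H = "\<lambda>t. \<mu> *\<^sub>R ((cmat G - mat l) ** Y t ** ?S)"
    have "((\<lambda>t. \<mu> *\<^sub>R ((cmat G - mat l) ** Y t ** ?S)) \<longlongrightarrow> \<mu> *\<^sub>R (0 ** ?S)) at_top"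
      by (intro tendsto_intros tendsto_matrix_mult[OF lim])
    then show "(?H \<longlongrightarrow> 0) at_top" by simp
    fix t :: real assume t: "t > 0"
    have "mat (of_real \<mu> * l) ** (Y t ** ?S) = \<mu> *\<^sub>R (mat l ** Y t ** ?S)"
      by (simp add: mat_mult_mat [symmetric] matrix_mul_assoc [symmetric] mat_of_real_mult
          matrix_mult_scaleR_left)
    then have "Y t ** cmat A + \<mu> *\<^sub>R (cmat G ** Y t ** ?S)
        = Y t ** cmat A + mat (of_real \<mu> * l) ** (Y t ** ?S) + ?H t"
      by (simp add: matrix_diff_rdistrib scaleR_diff_right)
    then show "(Y has_vector_derivative
        (Y t ** cmat A + mat (of_real \<mu> * l) ** (Y t ** ?S) + ?H t)) (at t)"
      using Y[OF t] by (simp only:)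
  qed
qed

lemma consensus_tendsto_zero:
  fixes A P :: "real^'n^'n" and B :: "real^'m^'n" and G :: "real^'p^'p" and r :: "real^'p"
    and Y :: "real \<Rightarrow> complex^'n^'p"
  defines "R \<equiv> cmat (rowvector r :: real^'p^1)"
  assumes P: "sym_pos_def P"
    and ric: "transpose A ** P + P ** A + mat 1 - P ** B ** transpose B ** P = 0"
    and conn: "connected_matrix G"
    and rG: "R ** cmat G = 0"
    and r1: "r \<bullet> 1 = 1"
    and spec: "\<And>k. is_eigenvalue (cmat G) k \<Longrightarrow> k \<noteq> 0 \<Longrightarrow> \<mu> * Re k \<le> - 1 / 2"
    and Y: "\<And>t. t > 0 \<Longrightarrow> (Y has_vector_derivative
         (Y t ** cmat A + \<mu> *\<^sub>R (cmat G ** Y t ** cmat (B ** transpose B ** P)))) (at t)"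
    and RY: "\<And>t. t > 0 \<Longrightarrow> R ** Y t = 0"
  shows "(Y \<longlongrightarrow> 0) at_top"
proof -
  let ?p = "matrix_poly (cmat G)"
  have "(Y \<longlongrightarrow> 0) at_top" if "q \<noteq> 0" "((\<lambda>t. ?p q ** Y t) \<longlongrightarrow> 0) at_top" for q
    using that
  proof (induction "degree q" arbitrary: q)
    case 0
    \<comment> \<open>A nonzero constant acts invertibly, so nothing is left to peel and
      \<open>Y\<close> is recovered by dividing.\<close>
    then obtain c where c: "q = [:c:]" "c \<noteq> 0" by (metis degree_eq_zeroE pCons_0_0)
    have "((\<lambda>t. mat (1 / c) ** (?p q ** Y t)) \<longlongrightarrow> mat (1 / c) ** 0) at_top"
      by (intro tendsto_matrix_mult tendsto_const 0)
    moreover have "mat (1 / c) ** (?p q ** Y t) = Y t" for t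
      using c by (simp add: matrix_mul_assoc mat_mult_mat)
    ultimately show ?case by simp
  next
    case (Suc d)
    then have "\<not> constant (poly q)" by (simp add: constant_degree)
    then obtain l where "poly q l = 0" using fundamental_theorem_of_algebra by blast
    then obtain q' where q': "q = [:- l, 1:] * q'" by (metis dvdE poly_eq_0_iff_dvd)
    have "q' \<noteq> 0" using q' Suc.prems(1) by auto
    moreover have "d = degree q'"
      using Suc.hyps(2) \<open>q' \<noteq> 0\<close> unfolding q' by (subst (asm) degree_mult_eq) auto
    moreover have "((\<lambda>t. ?p q' ** Y t) \<longlongrightarrow> 0) at_top"
    proof (rule consensus_factor[OF P ric conn r1 spec])
      show "((\<lambda>t. (cmat G - mat l) ** (?p q' ** Y t)) \<longlongrightarrow> 0) at_top"
        using Suc.prems(2) unfolding q' matrix_poly_linear_factor by (simp add: matrix_mul_assoc)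
      fix t :: real assume t: "t > 0"
      show "cmat (rowvector r :: real^'p^1) ** (?p q' ** Y t) = 0"
        using RY[OF t] row_matrix_poly[OF rG, of q'] unfolding R_def [symmetric]
        by (simp add: matrix_mul_assoc) (simp add: matrix_mul_assoc [symmetric])
      \<comment> \<open>Commutation with \<open>cmat G\<close> is what makes the transformed error a
        solution of the same equation.\<close>
      have "?p q' ** (cmat G ** Y t ** Z) = cmat G ** (?p q' ** Y t) ** Z" for Z :: "complex^'n^'n"
        by (simp add: matrix_mul_assoc matrix_poly_commute)
      then show "((\<lambda>t. ?p q' ** Y t) has_vector_derivative
          (?p q' ** Y t ** cmat A + \<mu> *\<^sub>R (cmat G ** (?p q' ** Y t) ** cmat (B ** transpose B ** P)))) (at t)"
        using has_vector_derivative_matrix_mult_right[OF Y[OF t], of "?p q'"]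
        by (simp add: matrix_add_ldistrib matrix_mult_scaleR_left matrix_mult_scaleR_right matrix_mul_assoc)
    qed
    ultimately show ?case using Suc.hyps(1) by blast
  qed
  \<comment> \<open>For an annihilating \<open>q\<close> the premise of the descent holds trivially,
    its function being identically zero.\<close>
  moreover obtain q where "q \<noteq> 0" "?p q = 0" using annihilating_polynomial .
  moreover have "((\<lambda>t. (0 :: complex^'p^'p) ** Y t) \<longlongrightarrow> 0) at_top" by simp
  ultimately show ?thesis by metis
qed

section \<open>The matrix exponential and linear equations\<close>

lemma has_vector_derivative_vec_lambda:
  assumes "\<And>i. (f i has_vector_derivative D i) (at t within S)"
  shows "((\<lambda>t. \<chi> i. f i t) has_vector_derivative (\<chi> i. D i)) (at t within S)"
  unfolding has_vector_derivative_def has_derivative_within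
proof (intro conjI vec_tendstoI)
  fix i
  have "((\<lambda>y. (1 / norm (y - t)) *\<^sub>R (f i y - (f i t + (y - t) *\<^sub>R D i))) \<longlongrightarrow> 0) (at t within S)"
    using assms[of i] unfolding has_vector_derivative_def has_derivative_within by blast
  then show "((\<lambda>y. ((1 / norm (y - t)) *\<^sub>R
      ((\<chi> i. f i y) - ((\<chi> i. f i t) + (y - t) *\<^sub>R (\<chi> i. D i)))) $ i) \<longlongrightarrow> 0 $ i)
      (at t within S)"
    by simp
qed (rule bounded_linear_scaleR_left)

lemma summable_matrix_exp:
  fixes M :: "real^'n^'n"
  shows "summable (\<lambda>k. (1 / fact k) *\<^sub>R matrix_power M k)"
proof -
  obtain K where K: "K > 0" "\<And>(X :: real^'n^'n) (Y :: real^'n^'n). norm (X ** Y) \<le> norm X * norm Y * K"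
    using matrix_norm_mult_bound by blast
  have power: "norm (matrix_power M k) \<le> norm (mat 1 :: real^'n^'n) * (norm M * K) ^ k" for k
  proof (induction k)
    case (Suc k)
    have "norm (matrix_power M (Suc k)) \<le> (norm M * K) * norm (matrix_power M k)"
      using K(2)[of M "matrix_power M k"] by (simp add: matrix_power_def mult_ac)
    also have "\<dots> \<le> (norm M * K) * (norm (mat 1 :: real^'n^'n) * (norm M * K) ^ k)"
      using Suc K(1) by (intro mult_left_mono) auto
    finally show ?case by (simp add: mult_ac)
  qed (simp add: matrix_power_def)
  have "summable (\<lambda>k. norm (mat 1 :: real^'n^'n) * (inverse (fact k) * (norm M * K) ^ k))"
    by (intro summable_mult summable_exp)
  then show ?thesis
    by (rule summable_comparison_test'[where N = 0])
       (use power in \<open>simp add: divide_simps mult_ac\<close>)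
qed

lemma matrix_power_scaleR: "matrix_power (t *\<^sub>R M) k = t ^ k *\<^sub>R matrix_power M k"
  by (induction k)
     (simp_all add: matrix_power_def matrix_mult_scaleR_left matrix_mult_scaleR_right)

lemma matrix_exp_0: "matrix_exp (0 :: real^'n^'n) = mat 1"
proof -
  have [simp]: "matrix_power (0 :: real^'n^'n) k = (if k = 0 then mat 1 else 0)" for k
    by (cases k) (simp_all add: matrix_power_def)
  show ?thesis
    unfolding matrix_exp_def by (subst suminf_finite[of "{0}"]) auto
qed

text \<open>Each entry is an everywhere convergent scalar power series and may be differentiated
  termwise.\<close>

lemma matrix_exp_has_vector_derivative:
  fixes M :: "real^'n^'n"
  shows "((\<lambda>t. matrix_exp (t *\<^sub>R M)) has_vector_derivative M ** matrix_exp (t *\<^sub>R M)) (at t within S)"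
proof -
  define c where "c i j k = matrix_power M k $ i $ j / fact k" for i j k
  have bl: "bounded_linear (\<lambda>X :: real^'n^'n. X $ i $ j)" for i j
    by (intro bounded_linear_compose[OF bounded_linear_vec_nth] bounded_linear_vec_nth)
  have sums: "(\<lambda>k. c i j k * s ^ k) sums (matrix_exp (s *\<^sub>R M) $ i $ j)" for i j s
    using bounded_linear.sums[OF bl summable_sums[OF summable_matrix_exp[of "s *\<^sub>R M"]], of i j]
    by (simp add: matrix_exp_def matrix_power_scaleR c_def mult.commute)
  \<comment> \<open>The factor \<open>k + 1\<close> from differentiation reduces the factorial, and
    the power \<open>Suc k\<close> releases one factor \<open>M\<close> on the left.\<close>
  have diffs: "diffs (c i j) k = (\<Sum>l\<in>UNIV. M $ i $ l * c l j k)" for i j k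
  proof -
    have "diffs (c i j) k = matrix_power M (Suc k) $ i $ j / fact k"
      by (simp add: diffs_def c_def)
    then show ?thesis
      by (simp add: c_def matrix_power_def matrix_matrix_mult_def sum_divide_distrib)
  qed
  have "((\<lambda>s. matrix_exp (s *\<^sub>R M) $ i $ j) has_vector_derivative
          (M ** matrix_exp (t *\<^sub>R M)) $ i $ j) (at t within S)" for i j
  proof -
    have "((\<lambda>s. \<Sum>k. c i j k * s ^ k) has_real_derivative (\<Sum>k. diffs (c i j) k * t ^ k)) (at t)"
      using sums by (intro termdiffs_strong_converges_everywhere) (rule sums_summable)
    moreover have "(\<Sum>k. c i j k * s ^ k) = matrix_exp (s *\<^sub>R M) $ i $ j" for s
      using sums_unique[OF sums] by simp
    moreover have "(\<lambda>k. diffs (c i j) k * t ^ k) sums ((M ** matrix_exp (t *\<^sub>R M)) $ i $ j)"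
      unfolding diffs sum_distrib_right mult.assoc matrix_matrix_mult_def vec_lambda_beta
      by (intro sums_sum sums_mult sums)
    ultimately show ?thesis
      by (simp add: has_real_derivative_iff_has_vector_derivative sums_iff has_vector_derivative_at_within)
  qed
  then have "((\<lambda>s. \<chi> i j. matrix_exp (s *\<^sub>R M) $ i $ j) has_vector_derivative
      (\<chi> i j. (M ** matrix_exp (t *\<^sub>R M)) $ i $ j)) (at t within S)"
    by (intro has_vector_derivative_vec_lambda)
  then show ?thesis by simp
qed

text \<open>Uniqueness by an energy argument: the difference \<open>d\<close> of the two solutions
  starts at 0, and its squared norm damped by \<open>exp (- 2 * K * u)\<close> cannot grow.\<close>

lemma linear_ode_eq_matrix_exp:
  fixes M :: "real^'n^'n" and s :: "real \<Rightarrow> real^'n"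
  assumes s: "\<And>t. t \<ge> 0 \<Longrightarrow> (s has_vector_derivative M *v s t) (at t within {0..})"
    and t: "t \<ge> 0"
  shows "s t = matrix_exp (t *\<^sub>R M) *v s 0"
proof -
  define d where "d u = s u - matrix_exp (u *\<^sub>R M) *v s 0" for u
  have bl: "bounded_linear (\<lambda>X :: real^'n^'n. X *v v)" for v
    by (subst linear_conv_bounded_linear [symmetric])
       (simp add: linear_iff matrix_vector_mult_add_rdistrib scaleR_matrix_vector_assoc)
  have d': "(d has_vector_derivative M *v d u) (at u within {0..})" if "u \<ge> 0" for u
  proof -
    have "(d has_vector_derivative M *v s u - M ** matrix_exp (u *\<^sub>R M) *v s 0) (at u within {0..})"
      unfolding d_def
      by (rule has_vector_derivative_diff[OF s[OF that]
            bounded_linear.has_vector_derivative[OF bl matrix_exp_has_vector_derivative]])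
    then show ?thesis
      by (simp add: d_def matrix_vector_mult_diff_distrib matrix_vector_mul_assoc)
  qed
  obtain K where K: "\<And>x. norm (M *v x) \<le> norm x * K"
    using bounded_linear.bounded[OF matrix_vector_mul_bounded_linear[of M]] by blast
  define f where "f u = inner (d u) (d u) * exp (- 2 * K * u)" for u
  have "f t \<le> f 0"
  \<comment> \<open>At 0 only a one-sided derivative is given, hence continuity on the closed
    interval and differentiation in its interior.\<close>
  proof (rule DERIV_nonpos_imp_decreasing_open[OF t])
    have "continuous_on {0..} d"
      unfolding continuous_on_eq_continuous_within
      by (auto intro: has_vector_derivative_continuous[OF d'])
    then show "continuous_on {0..t} f"
      unfolding f_def by (intro continuous_intros) (auto elim: continuous_on_subset)
    fix u assume u: "0 < u" "u < t"
    have du: "(d has_vector_derivative M *v d u) (at u)"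
      using d'[of u] u at_within_interior[of u "{0..}"] by simp
    have "((\<lambda>u. inner (d u) (d u)) has_vector_derivative
            inner (d u) (M *v d u) + inner (M *v d u) (d u)) (at u)"
      by (rule bounded_bilinear.has_vector_derivative[OF bounded_bilinear_inner du du])
    then have "(f has_real_derivative
        2 * (inner (d u) (M *v d u) - K * inner (d u) (d u)) * exp (- 2 * K * u)) (at u)"
      unfolding f_def has_real_derivative_iff_has_vector_derivative [symmetric]
      by (auto intro!: derivative_eq_intros simp: inner_commute algebra_simps)
    moreover have "inner (d u) (M *v d u) - K * inner (d u) (d u) \<le> 0"
    proof -
      have "inner (d u) (M *v d u) \<le> norm (d u) * norm (M *v d u)"
        by (rule norm_cauchy_schwarz)
      also have "\<dots> \<le> norm (d u) * (norm (d u) * K)"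
        by (rule mult_left_mono[OF K]) simp
      finally show ?thesis
        by (simp add: power2_norm_eq_inner [symmetric] power2_eq_square mult_ac)
    qed
    then have "2 * (inner (d u) (M *v d u) - K * inner (d u) (d u)) * exp (- 2 * K * u) \<le> 0"
      by (simp add: mult_nonpos_nonneg)
    ultimately show "\<exists>y. (f has_real_derivative y) (at u) \<and> y \<le> 0"
      by blast
  qed
  moreover have "d 0 = 0"
    by (simp add: d_def matrix_exp_0)
  ultimately have "inner (d t) (d t) \<le> 0"
    by (simp add: f_def mult_le_0_iff)
  then have "d t = 0"
    by (simp add: power2_norm_eq_inner [symmetric])
  then show ?thesis by (simp add: d_def)
qed

text \<open>Identifies \<open>xbar\<close> as the free motion started at the weighted mean of the
  initial states.\<close>

lemma single_block_kronecker_rowvector: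
  "single_block (kronecker (rowvector r :: real^'p^1) N *v stack x) = N *v (\<Sum>j\<in>UNIV. r $ j *\<^sub>R x j)"
proof -
  have "(\<Sum>s\<in>UNIV. r $ fst s * N $ i $ snd s * x (fst s) $ snd s)
      = (\<Sum>k\<in>UNIV. \<Sum>j\<in>UNIV. N $ i $ k * (r $ j * x j $ k))" for i
  proof -
    have "(\<Sum>s\<in>UNIV \<times> UNIV. r $ fst s * N $ i $ snd s * x (fst s) $ snd s)
      = (\<Sum>j\<in>UNIV. \<Sum>k\<in>UNIV. r $ j * N $ i $ k * x j $ k)"
      unfolding sum.cartesian_product by (simp add: case_prod_unfold)
    also have "\<dots> = (\<Sum>k\<in>UNIV. \<Sum>j\<in>UNIV. r $ j * N $ i $ k * x j $ k)"
      by (rule sum.swap)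
    finally show ?thesis by (simp add: mult_ac)
  qed
  then show ?thesis
    by (simp add: vec_eq_iff single_block_def kronecker_def stack_def rowvector_def
        matrix_vector_mult_def sum_distrib_left)
qed

section \<open>The coupled systems in matrix form\<close>

lemma matrix_mult_row: "(M ** N) $ i = transpose N *v (M $ i)"
  for M :: "'a::comm_semiring_1^'n^'m"
  by (simp add: vec_eq_iff matrix_matrix_mult_def matrix_vector_mult_def transpose_def mult.commute)

lemma matrix_mult_row_sum: "(M ** N) $ i = (\<Sum>j\<in>UNIV. M $ i $ j *\<^sub>R N $ j)" for M :: "real^'n^'m"
  by (simp add: vec_eq_iff matrix_matrix_mult_def)

theorem theorem2:
  fixes A P :: "real^'n^'n" and B L :: "real^'m^'n" and \<delta> :: real
    and \<Gamma> :: "real^'p^'p" and r :: "real^'p"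
    and x0 :: "'p \<Rightarrow> real^'n"
    and x u :: "'p \<Rightarrow> real \<Rightarrow> real^'n"
    and y z :: "'p \<Rightarrow> real \<Rightarrow> real^'m"
    and xbar :: "real \<Rightarrow> real^'n"
  assumes "detectable (transpose B) (transpose A)"
    and "sym_pos_def P"
    and "transpose A ** P + P ** A + mat 1 - P ** B ** transpose B ** P = 0"
    and "L = P ** B"
    and "\<delta> > 0"
    and "connected_matrix \<Gamma>"
    and "\<And>l. is_lambda2 \<Gamma> l \<Longrightarrow> - Re l \<ge> \<delta>"
    and "\<And>i t. t \<ge> 0 \<Longrightarrow>
           (x i has_vector_derivative (transpose A *v x i t + u i t)) (at t within {0..})"
    and "\<And>i t. t \<ge> 0 \<Longrightarrow> y i t = transpose B *v x i t"
    and "\<And>i t. t \<ge> 0 \<Longrightarrow> u i t = max 1 (inverse \<delta>) *\<^sub>R (L *v z i t)"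
    and "\<And>i t. t \<ge> 0 \<Longrightarrow> z i t = (\<Sum>j\<in>UNIV. \<Gamma> $ i $ j *\<^sub>R (y j t - y i t))"
    and "\<And>i. x i 0 = x0 i"
    and "r v* \<Gamma> = 0"
    and "r \<bullet> 1 = 1"
    and "\<And>t. xbar t = single_block
           (kronecker (rowvector r :: real^'p^1) (matrix_exp (t *\<^sub>R transpose A)) *v stack x0)"
  shows "\<forall>i. ((\<lambda>t. norm (x i t - xbar t)) \<longlongrightarrow> 0) at_top"
proof -
  define \<mu> where "\<mu> = max 1 (inverse \<delta>)"
  \<comment> \<open>The transpose of the feedback matrix \<open>L ** transpose B\<close>, since
    states are rows.\<close>
  define S where "S = B ** transpose B ** P"
  define X where "X t = (\<chi> i. x i t)" for t
  \<comment> \<open>\<open>J\<close> is 1 r^T: every row of \<open>J ** X t\<close> is the weighted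
    mean of the states.\<close>
  define J :: "real^'p^'p" where "J = (\<chi> i j. r $ j)"
  define E where "E t = X t - J ** X t" for t
  have symP: "transpose P = P" using assms(2) by (simp add: sym_pos_def_def)
  have rows: "(\<Sum>j\<in>UNIV. \<Gamma> $ i $ j) = 0" for i
    using assms(6) by (simp add: connected_matrix_def)
  have GJ: "\<Gamma> ** J = 0"
    using rows by (simp add: vec_eq_iff matrix_matrix_mult_def J_def sum_distrib_right [symmetric])
  have JG: "J ** \<Gamma> = 0"
    using assms(13) by (simp add: vec_eq_iff matrix_matrix_mult_def vector_matrix_mult_def J_def mult.commute)
  have rG: "(rowvector r :: real^'p^1) ** \<Gamma> = 0"
    using assms(13) by (simp add: vec_eq_iff matrix_matrix_mult_def vector_matrix_mult_def rowvector_def mult.commute)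
  have rsum: "(\<Sum>i\<in>UNIV. r $ i) = 1"
    using assms(14) by (simp add: inner_vec_def)
  have rJ: "(rowvector r :: real^'p^1) ** J = rowvector r"
    using rsum by (simp add: vec_eq_iff matrix_matrix_mult_def rowvector_def J_def sum_distrib_right [symmetric])
  have X': "(X has_vector_derivative (X t ** A + \<mu> *\<^sub>R (\<Gamma> ** X t ** S))) (at t within {0..})"
    if t: "t \<ge> 0" for t
  proof -
    have "z i t = transpose B *v (\<Gamma> ** X t) $ i" for i
    proof -
      have "z i t = (\<Sum>j\<in>UNIV. \<Gamma> $ i $ j *\<^sub>R y j t) - (\<Sum>j\<in>UNIV. \<Gamma> $ i $ j) *\<^sub>R y i t"
        by (simp add: assms(11)[OF t] scaleR_diff_right sum_subtractf scaleR_sum_left)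
      then show ?thesis
        by (simp add: rows matrix_mult_row_sum X_def assms(9)[OF t] linear_sum
            matrix_vector_mult_scaleR del: transpose_matrix_vector)
    qed
    then have "u i t = \<mu> *\<^sub>R (P ** B ** transpose B *v (\<Gamma> ** X t) $ i)" for i
      by (simp add: assms(10)[OF t] assms(4) \<mu>_def matrix_vector_mul_assoc matrix_mul_assoc
            del: transpose_matrix_vector)
    moreover have "transpose S = P ** B ** transpose B"
      by (simp add: S_def matrix_transpose_mul symP matrix_mul_assoc)
    ultimately have "(\<chi> i. transpose A *v x i t + u i t) = X t ** A + \<mu> *\<^sub>R (\<Gamma> ** X t ** S)"
      by (simp add: vec_eq_iff[where 'b = 'p] matrix_mult_row[of _ A] matrix_mult_row[of _ S] X_def
           del: transpose_matrix_vector)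
    then show ?thesis
      using has_vector_derivative_vec_lambda[where f = x, OF assms(8)[OF t]] unfolding X_def by simp
  qed
  \<comment> \<open>As r^T annihilates the coupling, the mean moves freely.\<close>
  have JX': "((\<lambda>t. J ** X t) has_vector_derivative (J ** X t ** A)) (at t within {0..})" if "t \<ge> 0" for t
    using has_vector_derivative_matrix_mult_right[OF X'[OF that], of J]
    by (simp add: matrix_add_ldistrib matrix_mult_scaleR_right matrix_mul_assoc JG)
  have E': "(E has_vector_derivative (E t ** A + \<mu> *\<^sub>R (\<Gamma> ** E t ** S))) (at t within {0..})" if "t \<ge> 0" for t
  proof -
    \<comment> \<open>The coupling does not see the mean because of \<open>GJ\<close>, so
      \<open>X\<close> may be replaced by \<open>E\<close> in it.\<close>
    have "X t ** A + \<mu> *\<^sub>R (\<Gamma> ** X t ** S) - J ** X t ** A = E t ** A + \<mu> *\<^sub>R (\<Gamma> ** E t ** S)"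
      by (simp add: E_def matrix_diff_ldistrib matrix_diff_rdistrib matrix_mul_assoc GJ)
    then show ?thesis
      using has_vector_derivative_diff[OF X'[OF that] JX'[OF that]] unfolding E_def [abs_def] by simp
  qed
  have spec: "\<mu> * Re k \<le> - 1 / 2" if k: "is_eigenvalue (cmat \<Gamma>) k" "k \<noteq> 0" for k
  proof -
    have "Re k \<le> 0"
      using assms(6) k(1) by (intro zero_row_sum_eigenvalue_Re_le[of \<Gamma>]) (auto simp: connected_matrix_def)
    moreover obtain l where "is_lambda2 \<Gamma> l" "\<bar>Re l\<bar> \<le> \<bar>Re k\<bar>"
      using eigenvalue_Re_le_of_lambda2[OF k] .
    \<comment> \<open>The relation \<open>is_lambda2\<close> compares absolute values of real parts;
      the sign known for \<open>Re k\<close> turns this into the one-sided bound.\<close>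
    ultimately have "Re k \<le> - \<delta>" using assms(7) by fastforce
    then have "\<mu> * Re k \<le> \<mu> * - \<delta>" by (intro mult_left_mono) (auto simp: \<mu>_def)
    moreover have "inverse \<delta> * \<delta> \<le> \<mu> * \<delta>"
      using assms(5) by (intro mult_right_mono) (auto simp: \<mu>_def)
    ultimately show ?thesis using assms(5) by simp
  qed
  have "((\<lambda>t. cmat (E t)) \<longlongrightarrow> 0) at_top"
  proof (rule consensus_tendsto_zero[OF assms(2,3,6) _ assms(14) spec])
    show "cmat (rowvector r :: real^'p^1) ** cmat \<Gamma> = 0"
      unfolding cmat_mult [symmetric] rG by (simp add: vec_eq_iff)
    fix t :: real assume t: "t > 0"
    have "(rowvector r :: real^'p^1) ** E t = 0"
      by (simp add: E_def matrix_diff_ldistrib matrix_mul_assoc rJ)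
    then show "cmat (rowvector r :: real^'p^1) ** cmat (E t) = 0"
      unfolding cmat_mult [symmetric] by (simp add: vec_eq_iff)
    have "bounded_linear (cmat :: real^'n^'p \<Rightarrow> _)"
      by (subst linear_conv_bounded_linear [symmetric]) (simp add: linear_iff cmat_add cmat_scaleR)
    moreover have "(E has_vector_derivative (E t ** A + \<mu> *\<^sub>R (\<Gamma> ** E t ** S))) (at t)"
      using E'[of t] t at_within_interior[of t "{0..}"] by simp
    ultimately have "((\<lambda>t. cmat (E t)) has_vector_derivative cmat (E t ** A + \<mu> *\<^sub>R (\<Gamma> ** E t ** S))) (at t)"
      by (rule bounded_linear.has_vector_derivative)
    then show "((\<lambda>t. cmat (E t)) has_vector_derivative
        cmat (E t) ** cmat A + \<mu> *\<^sub>R (cmat \<Gamma> ** cmat (E t) ** cmat (B ** transpose B ** P))) (at t)"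
      by (simp only: cmat_add cmat_scaleR cmat_mult S_def)
  qed
  then have "((\<lambda>t. Re (cmat (E t) $ i $ j)) \<longlongrightarrow> Re (0 $ i $ j)) at_top" for i j
    by (rule tendsto_Re[OF tendsto_vec_nth[OF tendsto_vec_nth]])
  then have E0: "((\<lambda>t. E t $ i) \<longlongrightarrow> 0) at_top" for i
    by (intro vec_tendstoI) simp
  have xbar: "(J ** X t) $ i = xbar t" if t: "t \<ge> 0" for i t
  proof -
    have "((\<lambda>t. (J ** X t) $ i) has_vector_derivative transpose A *v (J ** X t) $ i) (at t within {0..})"
      if "t \<ge> 0" for t
      using bounded_linear.has_vector_derivative[OF bounded_linear_vec_nth JX'[OF that], of i]
      by (simp only: matrix_mult_row[of _ A])
    \<comment> \<open>Every row of the mean solves the uncoupled equation, so uniqueness yields the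
      exponential formula.\<close>
    then have "(J ** X t) $ i = matrix_exp (t *\<^sub>R transpose A) *v (J ** X 0) $ i"
      using t by (rule linear_ode_eq_matrix_exp)
    also have "(J ** X 0) $ i = (\<Sum>j\<in>UNIV. r $ j *\<^sub>R x0 j)"
      by (simp add: matrix_mult_row_sum J_def X_def assms(12))
    finally show ?thesis
      by (simp add: assms(15) single_block_kronecker_rowvector)
  qed
  show ?thesis
  proof
    fix i
    have "((\<lambda>t. norm (E t $ i)) \<longlongrightarrow> 0) at_top"
      by (rule tendsto_norm_zero[OF E0])
    moreover have "norm (E t $ i) = norm (x i t - xbar t)" if "t \<ge> 0" for t
      using xbar[OF that, of i] by (simp add: E_def X_def)
    then have "eventually (\<lambda>t. norm (E t $ i) = norm (x i t - xbar t)) at_top"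
      by (rule eventually_mono[OF eventually_ge_at_top[of 0]])
    ultimately show "((\<lambda>t. norm (x i t - xbar t)) \<longlongrightarrow> 0) at_top"
      by (rule Lim_transform_eventually)
  qed
qed

end
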